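(* For every $n \geq 1$, the mixed separated number of $K_{n,n}$ equals $\lceil \frac{2n}{3} \rceil$.
   Context: Let $K_{n,n}$ have parts $U=\{u_0,\ldots,u_{n-1}\}$ and $V=\{v_0,\ldots,v_{n-1}\}$. A vertex order is separated if all vertices of one part precede all vertices of the other part. Given a total vertex order $\prec$, two edges $(a_1,b_1)$, $(a_2,b_2)$ with four distinct endpoints and $a_1\prec b_1$, $a_2 \prec b_2$, $a_1 \prec a_2$ are said to cross if $a_1 \prec a_2 \prec b_1 \prec b_2$, and to nest if $a_1 \prec a_2 \prec b_2 \prec b_1$. A stack is a set of edges no two of which cross; a queue is a set of edges no two of which nest. The mixed separated number of $K_{n,n}$ is the minimum $s+q$ such that there is a separated vertex order of $K_{n,n}$ and a partition of its edges into $s$ stacks and $q$ queues with respect to that order. *)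

theory Defs
  imports Complex_Main "HOL-Library.Disjoint_Sets"
begin

text \<open>
  The complete bipartite graph \<open>K\<^bsub>n,n\<^esub>\<close>: \<open>Inl i\<close> is the vertex \<open>u\<^sub>i\<close> and \<open>Inr j\<close> is the
  vertex \<open>v\<^sub>j\<close>. Edges are two-element sets of vertices.
\<close>

type_synonym vertex = "nat + nat"

definition part_U :: "nat \<Rightarrow> vertex set" where
  "part_U n = Inl ` {..<n}"

definition part_V :: "nat \<Rightarrow> vertex set" where
  "part_V n = Inr ` {..<n}"

definition Knn_verts :: "nat \<Rightarrow> vertex set" where
  "Knn_verts n = part_U n \<union> part_V n"

definition Knn_edges :: "nat \<Rightarrow> vertex set set" where
  "Knn_edges n = {{x, y} | x y. x \<in> part_U n \<and> y \<in> part_V n}"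

text \<open>
  Vertex orders are strict: \<open>(x, y) \<in> r\<close> means that \<open>x\<close> precedes \<open>y\<close>.
\<close>

definition vertex_order :: "nat \<Rightarrow> vertex rel \<Rightarrow> bool" where
  "vertex_order n r \<longleftrightarrow>
     r \<subseteq> Knn_verts n \<times> Knn_verts n \<and> strict_linear_order_on (Knn_verts n) r"

definition separated :: "nat \<Rightarrow> vertex rel \<Rightarrow> bool" where
  "separated n r \<longleftrightarrow>
     (\<forall>x\<in>part_U n. \<forall>y\<in>part_V n. (x, y) \<in> r) \<or>
     (\<forall>x\<in>part_U n. \<forall>y\<in>part_V n. (y, x) \<in> r)"

text \<open>
  The relations \<open>cross\<close> and \<open>nest\<close> are not symmetric: their first edge is the one whose earlier
  endpoint comes first. Quantifying over all ordered pairs of edges, as \<open>stack\<close> and \<open>queue\<close> do,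
  covers both cases.
\<close>

definition cross :: "'a rel \<Rightarrow> 'a set \<Rightarrow> 'a set \<Rightarrow> bool" where
  "cross r e f \<longleftrightarrow>
     (\<exists>a1 b1 a2 b2. e = {a1, b1} \<and> f = {a2, b2} \<and> distinct [a1, b1, a2, b2] \<and>
        (a1, b1) \<in> r \<and> (a2, b2) \<in> r \<and>
        (a1, a2) \<in> r \<and> (a2, b1) \<in> r \<and> (b1, b2) \<in> r)"

definition nest :: "'a rel \<Rightarrow> 'a set \<Rightarrow> 'a set \<Rightarrow> bool" where
  "nest r e f \<longleftrightarrow>
     (\<exists>a1 b1 a2 b2. e = {a1, b1} \<and> f = {a2, b2} \<and> distinct [a1, b1, a2, b2] \<and>
        (a1, b1) \<in> r \<and> (a2, b2) \<in> r \<and>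
        (a1, a2) \<in> r \<and> (a2, b2) \<in> r \<and> (b2, b1) \<in> r)"

definition stack :: "'a rel \<Rightarrow> 'a set set \<Rightarrow> bool" where
  "stack r S \<longleftrightarrow> (\<forall>e\<in>S. \<forall>f\<in>S. \<not> cross r e f)"

definition queue :: "'a rel \<Rightarrow> 'a set set \<Rightarrow> bool" where
  "queue r Q \<longleftrightarrow> (\<forall>e\<in>Q. \<forall>f\<in>Q. \<not> nest r e f)"

definition mixed_partition :: "'a rel \<Rightarrow> 'a set set \<Rightarrow> nat \<Rightarrow> nat \<Rightarrow> bool" where
  "mixed_partition r E s q \<longleftrightarrow>
     (\<exists>\<S> \<Q>. partition_on E (\<S> \<union> \<Q>) \<and> \<S> \<inter> \<Q> = {} \<and>
        finite \<S> \<and> card \<S> = s \<and> (\<forall>S\<in>\<S>. stack r S) \<and>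
        finite \<Q> \<and> card \<Q> = q \<and> (\<forall>Q\<in>\<Q>. queue r Q))"

definition mixed_separated_number :: "nat \<Rightarrow> nat" where
  "mixed_separated_number n =
     (LEAST k. \<exists>s q r. k = s + q \<and> vertex_order n r \<and> separated n r \<and>
        mixed_partition r (Knn_edges n) s q)"

end

theory Submission
  imports Defs
begin

text \<open>
  For a separated order, the edge joining the \<open>i\<close>-th vertex of the first part to the \<open>j\<close>-th vertex
  of the second is the cell \<open>(i, j)\<close> of an \<open>n \<times> n\<close> grid. Stacks are then sets of cells without a
  strictly increasing pair and queues are sets without a strictly decreasing pair. Since a stack meets
  every increasing diagonal at most once, \<open>s\<close> stacks cover at most \<open>s(2n - s)\<close> cells, and \<open>q\<close> queues
  cover at most \<open>q(2n - q)\<close>. Once enlarged to full lattice paths, each stack meets each queue, so \<open>sq\<close>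
  cells are counted twice and \<open>n\<^sup>2 + sq \<le> s(2n - s) + q(2n - q)\<close>, which forces \<open>3(s + q) \<ge> 2n\<close>.
  The bound is attained by a pinwheel of \<open>m\<close> monotone and \<open>m\<close> antitone paths in the
  \<open>3m \<times> 3m\<close> grid.
\<close>

section \<open>Chains in the grid and their ranks\<close>

definition inc_chain :: "(nat \<times> nat) set \<Rightarrow> bool" where
  "inc_chain C \<longleftrightarrow> (\<forall>p\<in>C. \<forall>q\<in>C. p \<noteq> q \<longrightarrow>
     fst p < fst q \<and> snd p < snd q \<or> fst q < fst p \<and> snd q < snd p)"

text \<open>The longest-common-subsequence recursion: \<open>rk A i j\<close> is the largest size of
  an increasing chain in \<open>A\<close> within the first \<open>i\<close> rows and
  \<open>j\<close> columns. The value 0 for a cell outside \<open>A\<close> is neutral under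
  \<open>max\<close>.\<close>

fun rk :: "(nat \<times> nat) set \<Rightarrow> nat \<Rightarrow> nat \<Rightarrow> nat" where
  "rk A 0 j = 0"
| "rk A (Suc i) 0 = 0"
| "rk A (Suc i) (Suc j) =
     max (max (rk A i (Suc j)) (rk A (Suc i) j)) (if (i, j) \<in> A then Suc (rk A i j) else 0)"

lemma rk_0_right [simp]: "rk A i 0 = 0"
  by (cases i) auto

lemma rk_mono_Suc: "rk A i j \<le> rk A (Suc i) j" "rk A i j \<le> rk A i (Suc j)"
  by (cases j; simp) (cases i; simp)

lemma rk_mono: "i \<le> i' \<Longrightarrow> j \<le> j' \<Longrightarrow> rk A i j \<le> rk A i' j'"
  using lift_Suc_mono_le[of "\<lambda>i. rk A i j" i i'] lift_Suc_mono_le[of "rk A i'" j j'] rk_mono_Suc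
  by (meson order_trans)

lemma rk_diag_ge: "rk A i j \<le> rk A (Suc i) (Suc j)"
  by (rule rk_mono) auto

text \<open>Each of the two neighbours \<open>(i, Suc j)\<close> and \<open>(Suc i, j)\<close> is
  itself the end of a diagonal step, which starts at a position whose rank is at most
  \<open>rk A i j\<close>. So every diagonal step is 0 or 1, and it is 1 at the cells of
  \<open>A\<close>.\<close>

lemma rk_diag_le: "rk A (Suc i) (Suc j) \<le> Suc (rk A i j)"
proof (induction "i + j" arbitrary: i j rule: less_induct)
  case less
  have "rk A i (Suc j) \<le> Suc (rk A i j)"
  proof (cases i)
    case (Suc i')
    then show ?thesis using less[of i' j] rk_mono_Suc(1)[of A i' j] by auto
  qed simp
  moreover have "rk A (Suc i) j \<le> Suc (rk A i j)"
  proof (cases j)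
    case (Suc j')
    then show ?thesis using less[of i j'] rk_mono_Suc(2)[of A i j'] by auto
  qed simp
  ultimately show ?case by simp
qed

lemma rk_diag_mem: "(i, j) \<in> A \<Longrightarrow> rk A (Suc i) (Suc j) = Suc (rk A i j)"
  using rk_diag_le[of A i j] by simp

lemma rk_le_left: "rk A i j \<le> i"
proof (induction i arbitrary: j)
  case (Suc i)
  then show ?case
    by (cases j) (auto intro: order_trans[OF rk_diag_le] simp del: rk.simps(3))
qed simp

lemma rk_le_right: "rk A i j \<le> j"
proof (induction j arbitrary: i)
  case (Suc j)
  then show ?case
    by (cases i) (auto intro: order_trans[OF rk_diag_le] simp del: rk.simps(3))
qed simp

lemma rk_full_diagonal:
  assumes "\<And>k. k < j \<Longrightarrow> (d + k, k) \<in> A"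
  shows "j \<le> rk A (d + j) j"
  using assms by (induction j) auto

text \<open>Tracing back which argument of \<open>max\<close> wins builds the chain. This turns
  bounds on chain sizes into bounds on ranks.\<close>

lemma rk_attained:
  "\<exists>C \<subseteq> A \<inter> {..<i} \<times> {..<j}. inc_chain C \<and> card C = rk A i j"
proof (induction A i j rule: rk.induct)
  case (3 A i j)
  have "rk A (Suc i) (Suc j) = rk A i (Suc j) \<or> rk A (Suc i) (Suc j) = rk A (Suc i) j \<or>
      (i, j) \<in> A \<and> rk A (Suc i) (Suc j) = Suc (rk A i j)"
    by (auto simp: max_def)
  then consider "rk A (Suc i) (Suc j) = rk A i (Suc j)" | "rk A (Suc i) (Suc j) = rk A (Suc i) j"
    | "(i, j) \<in> A" "rk A (Suc i) (Suc j) = Suc (rk A i j)"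
    by blast
  then show ?case
  proof cases
    case 1
    obtain C where "C \<subseteq> A \<inter> {..<i} \<times> {..<Suc j}" "inc_chain C" "card C = rk A i (Suc j)"
      using 3(1) by blast
    then show ?thesis using 1 by (intro exI[of _ C]) (auto simp del: rk.simps)
  next
    case 2
    obtain C where "C \<subseteq> A \<inter> {..<Suc i} \<times> {..<j}" "inc_chain C" "card C = rk A (Suc i) j"
      using 3(2) by blast
    then show ?thesis using 2 by (intro exI[of _ C]) (auto simp del: rk.simps)
  next
    case c: 3
    obtain C where C: "C \<subseteq> A \<inter> {..<i} \<times> {..<j}" "inc_chain C" "card C = rk A i j"
      using 3(3)[OF c(1)] by blast
    have "finite C" using C(1) by (rule finite_subset) auto
    moreover have "(i, j) \<notin> C" using C(1) by auto
    moreover have "inc_chain (insert (i, j) C)"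
      using C(1,2) unfolding inc_chain_def by fastforce
    ultimately show ?thesis using C c
      by (intro exI[of _ "insert (i, j) C"]) (auto simp del: rk.simps)
  qed
qed (auto simp: inc_chain_def)

text \<open>The members before \<open>(i, j)\<close> have distinct columns below \<open>j\<close>,
  those after it distinct rows above \<open>i\<close>, so there are at most
  \<open>j + 1 + (n - 1 - i)\<close> in all.\<close>

lemma inc_chain_card_le:
  assumes C: "inc_chain C" "C \<subseteq> {..<n} \<times> {..<n}" and p: "(i, j) \<in> C" "j \<le> i"
  shows "card C \<le> n - (i - j)"
proof -
  define L where "L = {p \<in> C. snd p < j}"
  define R where "R = {p \<in> C. i < fst p}"
  have fin: "finite C" using C(2) by (rule finite_subset) auto
  have "C \<subseteq> insert (i, j) (L \<union> R)"
  proof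
    fix p assume "p \<in> C"
    then show "p \<in> insert (i, j) (L \<union> R)"
      using C(1) p(1) unfolding inc_chain_def L_def R_def by force
  qed
  then have "card C \<le> card (insert (i, j) (L \<union> R))"
    using fin by (intro card_mono) (auto simp: L_def R_def)
  also have "\<dots> \<le> Suc (card (L \<union> R))" by (rule card_insert_le_m1) auto
  also have "\<dots> \<le> Suc (card L + card R)" using card_Un_le[of L R] by simp
  also have "card L \<le> card {..<j}"
    using C(1) by (intro card_inj_on_le[of snd]) (fastforce simp: L_def inc_chain_def inj_on_def)+
  also have "card R \<le> card {i<..<n}"
    using C by (intro card_inj_on_le[of fst]) (fastforce simp: R_def inc_chain_def inj_on_def)+
  finally show ?thesis using p C(2) by auto
qed

section \<open>Lower bound\<close>

text \<open>A diagonal step is a step in \<open>j\<close> followed by a step in \<open>i\<close>;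
  the first kind telescopes along rows, the second along columns.\<close>

lemma sum_diagonal_differences:
  fixes a :: "nat \<Rightarrow> nat \<Rightarrow> int"
  assumes "\<And>j. a 0 j = 0" "\<And>i. a i 0 = 0"
  shows "(\<Sum>i<n. \<Sum>j<n. a (Suc i) (Suc j) - a i j) = (\<Sum>k<n. a (Suc k) n + a n k)"
proof -
  have "(\<Sum>j<n. a (Suc i) (Suc j) - a i j) = a (Suc i) n + (\<Sum>j<n. a (Suc i) j - a i j)" for i
  proof -
    have "(\<Sum>j<n. a (Suc i) (Suc j) - a (Suc i) j) = a (Suc i) n"
      using assms by (simp add: sum_lessThan_telescope)
    then show ?thesis by (simp add: sum_subtractf)
  qed
  moreover have "(\<Sum>i<n. a (Suc i) j - a i j) = a n j" for j
    using assms sum_lessThan_telescope[of "\<lambda>i. a i j" n] by simp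
  then have "(\<Sum>i<n. \<Sum>j<n. a (Suc i) j - a i j) = (\<Sum>j<n. a n j)"
    by (subst sum.swap) simp
  ultimately show ?thesis by (simp add: sum.distrib)
qed

text \<open>The branch \<open>n * n\<close> carries the induction as long as \<open>n\<close> is
  below \<open>s\<close>.\<close>

lemma sum_min_consecutive:
  "(\<Sum>k<n. int (min s (Suc k)) + int (min s k)) =
     (if s \<le> n then int s * (2 * int n - int s) else int n * int n)"
proof (induction n)
  case (Suc n)
  consider "s \<le> n" | "s = Suc n" | "Suc n < s" by linarith
  then show ?case using Suc by cases (simp_all add: algebra_simps)
qed simp

text \<open>Only ranks on the last row and column survive the telescoping, and there the rank is
  bounded both by \<open>s\<close> and by the smaller coordinate.\<close>

lemma sum_rk_steps_le:
  assumes "\<And>i j. i \<le> n \<Longrightarrow> j \<le> n \<Longrightarrow> rk A i j \<le> s" "s \<le> n"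
  shows "(\<Sum>i<n. \<Sum>j<n. int (rk A (Suc i) (Suc j)) - int (rk A i j)) \<le> int s * (2 * int n - int s)"
proof -
  have "(\<Sum>i<n. \<Sum>j<n. int (rk A (Suc i) (Suc j)) - int (rk A i j))
      = (\<Sum>k<n. int (rk A (Suc k) n) + int (rk A n k))"
    by (rule sum_diagonal_differences) auto
  also have "\<dots> \<le> (\<Sum>k<n. int (min s (Suc k)) + int (min s k))"
    using assms by (intro sum_mono add_mono) (auto intro: rk_le_left rk_le_right simp del: rk.simps)
  also have "\<dots> = int s * (2 * int n - int s)"
    using assms(2) by (simp add: sum_min_consecutive)
  finally show ?thesis .
qed

text \<open>
  The level sets of \<open>rk A\<close> and of the mirrored \<open>rk B\<close> are bounded by lattice paths running in
  transverse directions, so two such paths meet. \<open>F\<close> and \<open>G\<close> give the heights of the two paths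
  over a column, and the meeting point lies in the first column after which \<open>F \<le> G\<close>.
\<close>

lemma common_step:
  assumes A: "\<And>k. k \<le> s \<Longrightarrow> k \<le> rk A n k" and B: "\<And>k. k \<le> q \<Longrightarrow> k \<le> rk B n k"
    and "s + q \<le> n" and x: "x < s" and y: "y < q"
  shows "\<exists>i<n. \<exists>j<n. rk A i j = x \<and> rk A (Suc i) (Suc j) = Suc x \<and>
           rk B i (n - Suc j) = y \<and> rk B (Suc i) (Suc (n - Suc j)) = Suc y"
proof -
  \<comment> \<open>The disjunct \<open>n < i\<close> guarantees that the minimum exists: the
    default \<open>Suc n\<close> means that rank \<open>x\<close> is not exceeded in column
    \<open>j\<close> within the grid.\<close>
  define F where "F j = (LEAST i. n < i \<or> x < rk A i j)" for j
  define G where "G j = (LEAST i. n < i \<or> y < rk B i (n - j))" for j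
  have F1: "n < F j \<or> x < rk A (F j) j" for j
    unfolding F_def by (rule LeastI[of _ "Suc n"]) simp
  have G1: "n < G j \<or> y < rk B (G j) (n - j)" for j
    unfolding G_def by (rule LeastI[of _ "Suc n"]) simp
  have Fle: "F j \<le> i" if "n < i \<or> x < rk A i j" for i j
    unfolding F_def using that by (rule Least_le)
  have Gle: "G j \<le> i" if "n < i \<or> y < rk B i (n - j)" for i j
    unfolding G_def using that by (rule Least_le)
  have Fanti: "F (Suc j) \<le> F j" for j
    using F1[of j] rk_mono_Suc(2)[of A "F j" j] by (intro Fle) linarith
  have Gmono: "G j \<le> G (Suc j)" for j
    using G1[of "Suc j"] rk_mono[of "G (Suc j)" "G (Suc j)" "n - Suc j" "n - j" B]
    by (intro Gle) force
  have Fgt: "j \<le> x" if "n < F j" for j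
  proof (rule ccontr)
    assume "\<not> j \<le> x"
    then have "Suc x \<le> rk A n j"
      using A[of "Suc x"] x rk_mono[of n n "Suc x" j A] by linarith
    then show False using Fle[of n j] that by linarith
  qed
  have Ggt: "n - j \<le> y" if "n < G j" for j
  proof (rule ccontr)
    assume "\<not> n - j \<le> y"
    then have "Suc y \<le> rk B n (n - j)"
      using B[of "Suc y"] y rk_mono[of n n "Suc y" "n - j" B] by linarith
    then show False using Gle[of n j] that by linarith
  qed
  have "n > 0" using assms by linarith
  have F0: "n < F 0" using F1[of 0] by simp
  have Gn: "n < G n" using G1[of n] by simp
  have Fn: "F j \<le> Suc n" for j by (rule Fle) simp
  have Gle': "G j \<le> Suc n" for j by (rule Gle) simp
  define j where "j = (LEAST j. F (Suc j) \<le> G (Suc j))"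
  have ex: "F (Suc (n - 1)) \<le> G (Suc (n - 1))" using Gn Fn[of n] \<open>n > 0\<close> by simp
  have j1: "F (Suc j) \<le> G (Suc j)" unfolding j_def by (rule LeastI, rule ex)
  have "j \<le> n - 1" unfolding j_def by (rule Least_le, rule ex)
  then have jn: "j < n" using \<open>n > 0\<close> by linarith
  have j2: "G j \<le> F j"
  proof (cases j)
    case 0
    then show ?thesis using F0 Gle'[of 0] by simp
  next
    case (Suc k)
    then have "\<not> F (Suc k) \<le> G (Suc k)"
      using not_less_Least[of k "\<lambda>j. F (Suc j) \<le> G (Suc j)"] unfolding j_def by simp
    then show ?thesis using Suc by simp
  qed
  have pos: "F (Suc j) > 0" using F1[of "Suc j"] by (cases "F (Suc j)") auto
  \<comment> \<open>The cell ends where both ranks have just been exceeded: \<open>Suc i\<close> is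
    at least \<open>F (Suc j)\<close> and \<open>G j\<close>, yet \<open>i\<close> stays below
    \<open>F j\<close> and \<open>G (Suc j)\<close>.\<close>
  define i where "i = max (F (Suc j)) (G j) - 1"
  have Suc_i: "Suc i = max (F (Suc j)) (G j)" using pos unfolding i_def by simp
  \<comment> \<open>If the default value occurred, both paths would be undefined here, giving
    \<open>n \<le> x + y\<close>, against \<open>x + y < s + q \<le> n\<close>.\<close>
  have FS: "F (Suc j) \<le> n"
    using Fgt[of "Suc j"] Ggt[of "Suc j"] j1 assms(3) x y by linarith
  have GS: "G j \<le> n"
    using Fgt[of j] Ggt[of j] j2 assms(3) x y by linarith
  have "i < n" using FS GS Suc_i by linarith
  have "i < F j" "i < G (Suc j)" using Suc_i Fanti[of j] Gmono[of j] j1 j2 by linarith+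
  then have 1: "rk A i j \<le> x" and 3: "rk B i (n - Suc j) \<le> y"
    using Fle[of i j] Gle[of i "Suc j"] by (meson not_le)+
  have 2: "x < rk A (Suc i) (Suc j)"
    using F1[of "Suc j"] FS rk_mono[of "F (Suc j)" "Suc i" "Suc j" "Suc j" A] Suc_i by linarith
  have "y < rk B (Suc i) (n - j)"
    using G1[of j] GS rk_mono[of "G j" "Suc i" "n - j" "n - j" B] Suc_i by linarith
  then have 4: "y < rk B (Suc i) (Suc (n - Suc j))"
    using jn by (simp add: Suc_diff_Suc del: rk.simps)
  show ?thesis
    using 1 2 3 4 rk_diag_le[of A i j] rk_diag_le[of B i "n - Suc j"] \<open>i < n\<close> jn
    by (intro exI[of _ i] exI[of _ j] conjI) linarith+
qed

text \<open>
  \<open>A'\<close> adds to \<open>A\<close> the corner \<open>i - j \<ge> n - s\<close>, where every diagonal has at most \<open>s\<close> cells.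
\<close>

lemma add_corner:
  assumes chain: "\<And>C. C \<subseteq> A \<Longrightarrow> C \<subseteq> {..<n} \<times> {..<n} \<Longrightarrow> inc_chain C \<Longrightarrow> card C \<le> s" and "s \<le> n"
  obtains A' where "A \<subseteq> A'" "\<And>i j. i \<le> n \<Longrightarrow> j \<le> n \<Longrightarrow> rk A' i j \<le> s"
    "\<And>k. k \<le> s \<Longrightarrow> k \<le> rk A' n k"
proof
  let ?A = "A \<union> {(i, j). j + (n - s) \<le> i}"
  show "A \<subseteq> ?A" by blast
  show "rk ?A i j \<le> s" if ij: "i \<le> n" "j \<le> n" for i j
  proof -
    obtain C where C: "C \<subseteq> ?A \<inter> {..<i} \<times> {..<j}" "inc_chain C" "card C = rk ?A i j"
      using rk_attained by blast
    have sub: "C \<subseteq> {..<n} \<times> {..<n}" using C(1) ij by force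
    have "card C \<le> s"
    proof (cases "C \<subseteq> A")
      case True
      then show ?thesis using chain C(2) sub by blast
    next
      case False
      then obtain p r where "(p, r) \<in> C" "r + (n - s) \<le> p" using C(1) by blast
      then show ?thesis using inc_chain_card_le[OF C(2) sub, of p r] \<open>s \<le> n\<close> by linarith
    qed
    then show ?thesis using C(3) by simp
  qed
  show "k \<le> rk ?A n k" if "k \<le> s" for k
  proof -
    \<comment> \<open>The diagonal starting at \<open>(n - k, 0)\<close> lies wholly in the corner
      and has \<open>k\<close> cells.\<close>
    have "k \<le> rk ?A (n - k + k) k"
      using that \<open>s \<le> n\<close> by (intro rk_full_diagonal) auto
    then show ?thesis using that \<open>s \<le> n\<close> by simp
  qed
qed

text \<open>The columns of \<open>B\<close> are reversed, so decreasing pairs become increasing ones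
  and the same rank function serves queues.\<close>

lemma grid_cover_bound:
  assumes cover: "\<And>i j. i < n \<Longrightarrow> j < n \<Longrightarrow> (i, j) \<in> A \<or> (i, n - Suc j) \<in> B"
    and A: "\<And>C. C \<subseteq> A \<Longrightarrow> C \<subseteq> {..<n} \<times> {..<n} \<Longrightarrow> inc_chain C \<Longrightarrow> card C \<le> s"
    and B: "\<And>C. C \<subseteq> B \<Longrightarrow> C \<subseteq> {..<n} \<times> {..<n} \<Longrightarrow> inc_chain C \<Longrightarrow> card C \<le> q"
  shows "2 * n \<le> 3 * (s + q)"
proof (cases "s + q \<le> n")
  case True
  obtain A' where A': "A \<subseteq> A'" "\<And>i j. i \<le> n \<Longrightarrow> j \<le> n \<Longrightarrow> rk A' i j \<le> s"
    "\<And>k. k \<le> s \<Longrightarrow> k \<le> rk A' n k"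
    using add_corner[of A n s] A True by auto
  obtain B' where B': "B \<subseteq> B'" "\<And>i j. i \<le> n \<Longrightarrow> j \<le> n \<Longrightarrow> rk B' i j \<le> q"
    "\<And>k. k \<le> q \<Longrightarrow> k \<le> rk B' n k"
    using add_corner[of B n q] B True by auto
  \<comment> \<open>The steps \<open>a\<close> and \<open>b\<close> act as indicators of enlarged
    sets: they are 0 or 1, equal 1 on \<open>A'\<close> and \<open>B'\<close>, and have computable
    sums.\<close>
  define a where "a i j = int (rk A' (Suc i) (Suc j)) - int (rk A' i j)" for i j
  define b where "b i j = int (rk B' (Suc i) (Suc j)) - int (rk B' i j)" for i j
  define D where "D = {(i, j) \<in> {..<n} \<times> {..<n}. a i j = 1 \<and> b i (n - Suc j) = 1}"
  have finD: "finite D" unfolding D_def by (rule finite_subset[of _ "{..<n} \<times> {..<n}"]) auto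
  \<comment> \<open>Every pair of ranks labels a cell where both steps are 1, so at least
    \<open>s * q\<close> cells are counted twice.\<close>
  have "{..<s} \<times> {..<q} \<subseteq> (\<lambda>(i, j). (rk A' i j, rk B' i (n - Suc j))) ` D"
  proof
    fix z assume "z \<in> {..<s} \<times> {..<q}"
    then obtain x y where z: "z = (x, y)" "x < s" "y < q" by auto
    obtain i j where "i < n" "j < n" "rk A' i j = x" "rk A' (Suc i) (Suc j) = Suc x"
      "rk B' i (n - Suc j) = y" "rk B' (Suc i) (Suc (n - Suc j)) = Suc y"
      using common_step[OF A'(3) B'(3) True z(2,3)] by blast
    then show "z \<in> (\<lambda>(i, j). (rk A' i j, rk B' i (n - Suc j))) ` D"
      unfolding z(1) D_def a_def b_def by (intro image_eqI[of _ _ "(i, j)"]) (auto simp del: rk.simps)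
  qed
  then have "card ({..<s} \<times> {..<q}) \<le> card D"
    using finD by (meson card_image_le card_mono finite_imageI order_trans)
  then have "s * q \<le> card D" by simp
  have ge: "1 + (if (i, j) \<in> D then 1 else 0) \<le> a i j + b i (n - Suc j)" if "i < n" "j < n" for i j
  proof -
    have "a i j = 1 \<or> b i (n - Suc j) = 1"
      using cover[OF that] A'(1) B'(1) unfolding a_def b_def by (auto simp: rk_diag_mem simp del: rk.simps)
    moreover have "a i j \<ge> 0" "b i (n - Suc j) \<ge> 0"
      using rk_diag_ge unfolding a_def b_def by (simp_all del: rk.simps)
    ultimately show ?thesis unfolding D_def by auto
  qed
  have "int n * int n + int s * int q \<le> int n * int n + int (card D)"
    using \<open>s * q \<le> card D\<close> by (metis add_left_mono of_nat_le_iff of_nat_mult)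
  also have "int (card D) = (\<Sum>i<n. \<Sum>j<n. if (i, j) \<in> D then 1 else 0)"
  proof -
    have "D = {p \<in> {..<n} \<times> {..<n}. p \<in> D}" unfolding D_def by auto
    then have "int (card D) = (\<Sum>p\<in>{..<n} \<times> {..<n}. if p \<in> D then 1 else 0)"
      by (simp add: sum.If_cases Int_def)
    then show ?thesis by (simp add: sum.cartesian_product case_prod_unfold)
  qed
  also have "int n * int n + \<dots> = (\<Sum>i<n. \<Sum>j<n. 1 + (if (i, j) \<in> D then 1 else 0))"
    by (simp add: sum.distrib)
  also have "\<dots> \<le> (\<Sum>i<n. \<Sum>j<n. a i j + b i (n - Suc j))"
    using ge by (intro sum_mono) auto
  also have "\<dots> = (\<Sum>i<n. \<Sum>j<n. a i j) + (\<Sum>i<n. \<Sum>j<n. b i j)"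
    by (simp add: sum.distrib sum.nat_diff_reindex)
  also have "\<dots> \<le> int s * (2 * int n - int s) + int q * (2 * int n - int q)"
    unfolding a_def b_def using True A'(2) B'(2) by (intro add_mono sum_rk_steps_le) auto
  finally have main: "int n * int n + int s * int q
      \<le> int s * (2 * int n - int s) + int q * (2 * int n - int q)" .
  show ?thesis
  proof (rule ccontr)
    assume "\<not> ?thesis"
    \<comment> \<open>With \<open>t = s + q\<close>, four times \<open>main\<close> reads
      \<open>(2n - 3t)(2n - t) + (s - q)^2 \<le> 0\<close>, whereas both factors would now be
      positive.\<close>
    then have "0 < (2 * int n - 3 * (int s + int q)) * (2 * int n - (int s + int q))"
      by (intro mult_pos_pos) auto
    moreover have "0 \<le> (int s - int q) * (int s - int q)" by simp
    ultimately show False using main by (simp add: algebra_simps)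
  qed
qed simp

section \<open>From separated orders to the grid\<close>

text \<open>The position of an element is its number of predecessors; this is strictly increasing
  along \<open>r\<close>, and its inverse is the enumeration.\<close>

lemma strict_linear_order_enumeration:
  assumes "finite X" "trans r" "irrefl r" "total_on X r"
  obtains f where "bij_betw f {..<card X} X"
    "\<And>i j. i < j \<Longrightarrow> j < card X \<Longrightarrow> (f i, f j) \<in> r"
proof
  define p where "p x = card {y \<in> X. (y, x) \<in> r}" for x
  have less: "p x < p y" if "x \<in> X" "(x, y) \<in> r" for x y
    unfolding p_def using assms that
    by (intro psubset_card_mono) (auto dest: transD simp: irrefl_def)
  have inj: "inj_on p X"
    using less assms(4) unfolding inj_on_def total_on_def by (metis less_irrefl)
  have "p x < card X" if "x \<in> X" for x
    unfolding p_def using assms that by (intro psubset_card_mono) (auto simp: irrefl_def)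
  then have "p ` X = {..<card X}"
    using inj by (intro card_subset_eq) (auto simp: card_image)
  then have bij: "bij_betw p X {..<card X}" using inj by (simp add: bij_betw_def)
  then show "bij_betw (inv_into X p) {..<card X} X" by (rule bij_betw_inv_into)
  show "(inv_into X p i, inv_into X p j) \<in> r" if "i < j" "j < card X" for i j
  proof -
    have "inv_into X p i \<in> X" "inv_into X p j \<in> X" "p (inv_into X p i) = i" "p (inv_into X p j) = j"
      using bij that by (auto simp: bij_betw_def inv_into_into f_inv_into_f)
    then show ?thesis using less assms(4) that unfolding total_on_def
      by (metis less_asym less_irrefl)
  qed
qed

text \<open>Pigeonhole. It will be applied to an increasing chain, no two members of which can share
  a stack (or, after reflection, a queue).\<close>

lemma transversal_card_le:
  assumes "finite \<S>" and "\<And>c. c \<in> C \<Longrightarrow> \<exists>S\<in>\<S>. P c S"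
    and "\<And>c d S. c \<in> C \<Longrightarrow> d \<in> C \<Longrightarrow> S \<in> \<S> \<Longrightarrow> P c S \<Longrightarrow> P d S \<Longrightarrow> c = d"
  shows "card C \<le> card \<S>"
proof -
  obtain h where "\<And>c. c \<in> C \<Longrightarrow> h c \<in> \<S> \<and> P c (h c)" using assms(2) by metis
  moreover from this have "inj_on h C" using assms(3) by (metis inj_onI)
  ultimately show ?thesis using assms(1) by (intro card_inj_on_le[of h]) auto
qed

text \<open>Stated for arbitrary parts so that it covers both U before V and V before U.\<close>

lemma mixed_partition_bound:
  assumes X: "finite X" "card X = n" and Y: "finite Y" "card Y = n" and "X \<inter> Y = {}"
    and r: "trans r" "irrefl r" "total_on (X \<union> Y) r" and sep: "\<And>x y. x \<in> X \<Longrightarrow> y \<in> Y \<Longrightarrow> (x, y) \<in> r"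
    and mp: "mixed_partition r {{x, y} | x y. x \<in> X \<and> y \<in> Y} s q"
  shows "2 * n \<le> 3 * (s + q)"
proof -
  obtain \<S> \<Q> where P: "partition_on {{x, y} | x y. x \<in> X \<and> y \<in> Y} (\<S> \<union> \<Q>)"
    and S: "finite \<S>" "card \<S> = s" "\<And>S. S \<in> \<S> \<Longrightarrow> stack r S"
    and Q: "finite \<Q>" "card \<Q> = q" "\<And>Q. Q \<in> \<Q> \<Longrightarrow> queue r Q"
    using mp unfolding mixed_partition_def by blast
  have tot: "total_on X r" "total_on Y r" using r(3) by (auto simp: total_on_def)
  obtain f where f: "bij_betw f {..<n} X" "\<And>i j. i < j \<Longrightarrow> j < n \<Longrightarrow> (f i, f j) \<in> r"
    using strict_linear_order_enumeration[OF X(1) r(1,2) tot(1)] X(2) by metis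
  obtain g where g: "bij_betw g {..<n} Y" "\<And>i j. i < j \<Longrightarrow> j < n \<Longrightarrow> (g i, g j) \<in> r"
    using strict_linear_order_enumeration[OF Y(1) r(1,2) tot(2)] Y(2) by metis
  have fX: "f i \<in> X" and gY: "g i \<in> Y" if "i < n" for i
    using f(1) g(1) that by (auto simp: bij_betw_def)
  have neq: "f i \<noteq> f j" "g i \<noteq> g j" if "i < n" "j < n" "i \<noteq> j" for i j
    using f(1) g(1) that by (auto simp: bij_betw_def inj_on_def)
  have neq': "f i \<noteq> g j" "g j \<noteq> f i" if "i < n" "j < n" for i j 
    using fX[of i] gY[of j] that \<open>X \<inter> Y = {}\<close> by auto
  have cross: "cross r {f i, g j} {f i', g j'}" if "i < i'" "j < j'" "i' < n" "j' < n" for i j i' j'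
  proof -
    have "i < n" "j < n" using that by auto
    then show ?thesis
      unfolding cross_def using that neq(1)[of i i'] neq(2)[of j j'] neq' fX gY f(2) g(2) sep
      by (intro exI[of _ "f i"] exI[of _ "g j"] exI[of _ "f i'"] exI[of _ "g j'"]) auto
  qed
  have nest: "nest r {f i, g j} {f i', g j'}" if "i < i'" "j' < j" "i' < n" "j < n" for i j i' j'
  proof -
    have "i < n" "j' < n" using that by auto
    then show ?thesis
      unfolding nest_def using that neq(1)[of i i'] neq(2)[of j j'] neq' fX gY f(2) g(2) sep
      by (intro exI[of _ "f i"] exI[of _ "g j"] exI[of _ "f i'"] exI[of _ "g j'"]) auto
  qed
  let ?A = "{(i, j). \<exists>S\<in>\<S>. {f i, g j} \<in> S}"
  let ?B = "{(i, j). \<exists>Q\<in>\<Q>. {f i, g (n - Suc j)} \<in> Q}"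
  show ?thesis
  proof (rule grid_cover_bound[where A = ?A and B = ?B])
    show "(i, j) \<in> ?A \<or> (i, n - Suc j) \<in> ?B" if "i < n" "j < n" for i j
    proof -
      have "{f i, g j} \<in> \<Union> (\<S> \<union> \<Q>)"
        using P fX[OF that(1)] gY[OF that(2)] unfolding partition_on_def by blast
      moreover have "n - Suc (n - Suc j) = j" using that by simp
      ultimately show ?thesis by auto
    qed
    show "card C \<le> s" if C: "C \<subseteq> ?A" "C \<subseteq> {..<n} \<times> {..<n}" "inc_chain C" for C
    proof -
      have "c = d" if cd: "c \<in> C" "d \<in> C" "S \<in> \<S>" "{f (fst c), g (snd c)} \<in> S"
        "{f (fst d), g (snd d)} \<in> S" for c d S
      proof (rule ccontr)
        assume "c \<noteq> d"
        then have "fst c < fst d \<and> snd c < snd d \<or> fst d < fst c \<and> snd d < snd c"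
          using C(3) cd(1,2) unfolding inc_chain_def by blast
        then show False
          using cross[of "fst c" "fst d" "snd c" "snd d"] cross[of "fst d" "fst c" "snd d" "snd c"]
            S(3)[OF cd(3)] cd C(2) unfolding stack_def by fastforce
      qed
      then show ?thesis
        using transversal_card_le[OF S(1), of C "\<lambda>c S. {f (fst c), g (snd c)} \<in> S"] C(1) S(2)
        by fastforce
    qed
    show "card C \<le> q" if C: "C \<subseteq> ?B" "C \<subseteq> {..<n} \<times> {..<n}" "inc_chain C" for C
    proof -
      have "c = d" if cd: "c \<in> C" "d \<in> C" "S \<in> \<Q>" "{f (fst c), g (n - Suc (snd c))} \<in> S"
        "{f (fst d), g (n - Suc (snd d))} \<in> S" for c d S
      proof (rule ccontr)
        assume "c \<noteq> d"
        then have or: "fst c < fst d \<and> snd c < snd d \<or> fst d < fst c \<and> snd d < snd c"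
          using C(3) cd(1,2) unfolding inc_chain_def by blast
        have lt: "fst c < n" "snd c < n" "fst d < n" "snd d < n" using cd(1,2) C(2) by auto
        then have "snd c < snd d \<Longrightarrow> n - Suc (snd d) < n - Suc (snd c)"
          "snd d < snd c \<Longrightarrow> n - Suc (snd c) < n - Suc (snd d)" by linarith+
        then show False
          using or lt nest[of "fst c" "fst d" "n - Suc (snd d)" "n - Suc (snd c)"]
            nest[of "fst d" "fst c" "n - Suc (snd c)" "n - Suc (snd d)"]
            Q(3)[OF cd(3)] cd(4,5) unfolding queue_def by auto
      qed
      then show ?thesis
        using transversal_card_le[OF Q(1), of C "\<lambda>c S. {f (fst c), g (n - Suc (snd c))} \<in> S"] C(1) Q(2)
        by fastforce
    qed
  qed
qed

lemma separated_lower_bound: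
  assumes "vertex_order n r" "separated n r" "mixed_partition r (Knn_edges n) s q"
  shows "2 * n \<le> 3 * (s + q)"
proof -
  have r: "trans r" "irrefl r" "total_on (part_U n \<union> part_V n) r"
    using assms(1) unfolding vertex_order_def strict_linear_order_on_def Knn_verts_def by auto
  have UV: "finite (part_U n)" "card (part_U n) = n" "finite (part_V n)" "card (part_V n) = n"
    "part_U n \<inter> part_V n = {}"
    unfolding part_U_def part_V_def by (auto simp: card_image)
  consider "\<And>x y. x \<in> part_U n \<Longrightarrow> y \<in> part_V n \<Longrightarrow> (x, y) \<in> r"
    | "\<And>x y. x \<in> part_V n \<Longrightarrow> y \<in> part_U n \<Longrightarrow> (x, y) \<in> r"
    using assms(2) unfolding separated_def by blast
  then show ?thesis
  proof cases
    case 1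
    then show ?thesis
      using mixed_partition_bound[OF UV r] assms(3) unfolding Knn_edges_def by blast
  next
    case 2
    have "Knn_edges n = {{x, y} | x y. x \<in> part_V n \<and> y \<in> part_U n}"
      unfolding Knn_edges_def by (metis (no_types, opaque_lifting) insert_commute)
    then show ?thesis
      using mixed_partition_bound[OF UV(3,4,1,2) _ r(1,2) _ 2, of s q] UV(5) r(3) assms(3)
      by (simp add: Un_commute Int_commute)
  qed
qed

section \<open>Upper bound\<close>

definition antitone_cells :: "(nat \<times> nat) set \<Rightarrow> bool" where
  "antitone_cells S \<longleftrightarrow> (\<forall>(i, j)\<in>S. \<forall>(i', j')\<in>S. \<not> (i < i' \<and> j < j'))"

definition monotone_cells :: "(nat \<times> nat) set \<Rightarrow> bool" where
  "monotone_cells S \<longleftrightarrow> (\<forall>(i, j)\<in>S. \<forall>(i', j')\<in>S. \<not> (i < i' \<and> j' < j))"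

text \<open>Overlaps and cells outside the grid are allowed, which keeps the path formulas simple;
  disjointness is restored when edges are assigned to paths.\<close>

definition grid_cover :: "nat \<Rightarrow> nat \<Rightarrow> nat \<Rightarrow> bool" where
  "grid_cover n s q \<longleftrightarrow> (\<exists>S Q. (\<forall>t<s. antitone_cells (S t)) \<and> (\<forall>t<q. monotone_cells (Q t)) \<and>
     {..<n} \<times> {..<n} \<subseteq> (\<Union>t<s. S t) \<union> (\<Union>t<q. Q t))"

lemma grid_cover_mono:
  assumes "grid_cover n s q" "m \<le> n"
  shows "grid_cover m s q"
proof -
  have "{..<m} \<times> {..<m} \<subseteq> {..<n} \<times> {..<n}" using assms(2) by auto
  then show ?thesis using assms(1) unfolding grid_cover_def by (meson order_trans)
qed

text \<open>The last row and the last column together form one antitone path.\<close>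

lemma grid_cover_Suc:
  assumes "grid_cover n s q"
  shows "grid_cover (Suc n) (Suc s) q"
proof -
  obtain S Q where *: "\<forall>t<s. antitone_cells (S t)" "\<forall>t<q. monotone_cells (Q t)"
    "{..<n} \<times> {..<n} \<subseteq> (\<Union>t<s. S t) \<union> (\<Union>t<q. Q t)"
    using assms unfolding grid_cover_def by blast
  define L where "L = {(i, j). i \<le> n \<and> j \<le> n \<and> (i = n \<or> j = n)}"
  define S' where "S' = S(s := L)"
  have "antitone_cells L" unfolding antitone_cells_def L_def by auto
  then have "\<forall>t<Suc s. antitone_cells (S' t)" using *(1) by (simp add: S'_def less_Suc_eq)
  moreover have "{..<Suc n} \<times> {..<Suc n} \<subseteq> (\<Union>t<Suc s. S' t) \<union> (\<Union>t<q. Q t)"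
  proof -
    have "{..<Suc n} \<times> {..<Suc n} \<subseteq> {..<n} \<times> {..<n} \<union> L" unfolding L_def by auto
    also have "\<dots> \<subseteq> (\<Union>t<s. S t) \<union> (\<Union>t<q. Q t) \<union> L" by (rule Un_mono[OF *(3) subset_refl])
    also have "\<dots> = (\<Union>t<Suc s. S' t) \<union> (\<Union>t<q. Q t)"
      unfolding S'_def by (auto simp: less_Suc_eq)
    finally show ?thesis .
  qed
  ultimately show ?thesis unfolding grid_cover_def using *(2) by (intro exI[of _ S'] exI[of _ Q] conjI)
qed

text \<open>
  Cut the \<open>3m \<times> 3m\<close> grid into nine blocks of size \<open>m \<times> m\<close>. The monotone paths below follow the
  blocks \<open>(0,0), (0,1), (1,1), (2,1), (2,2)\<close>, turning along the antidiagonals of \<open>(0,1)\<close> and \<open>(2,1)\<close>.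
  Rotating them by a right angle gives antitone paths through the other four blocks.
\<close>

definition zigzag :: "nat \<Rightarrow> nat \<Rightarrow> (nat \<times> nat) set" where
  "zigzag m t = {(i, j). i = t \<and> j + t < 2 * m \<or> Suc (j + t) = 2 * m \<and> t \<le> i \<and> i \<le> 2 * m + t \<or>
     i = 2 * m + t \<and> 2 * m \<le> Suc (j + t)}"

lemma monotone_zigzag: "monotone_cells (zigzag m t)"
  unfolding monotone_cells_def zigzag_def by auto

lemma zigzag_cover:
  assumes "i < m \<and> j < 2 * m \<or> m \<le> i \<and> i < 3 * m \<and> m \<le> j \<and> j < 2 * m \<or>
    2 * m \<le> i \<and> i < 3 * m \<and> m \<le> j"
  shows "\<exists>t<m. (i, j) \<in> zigzag m t"
proof -
  \<comment> \<open>The blocks are regrouped by the antidiagonals where the paths turn, one case for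
    each leg of a path; each leg determines its \<open>t\<close> from \<open>i\<close> or
    \<open>j\<close>.\<close>
  consider "i < m" "i + j < 2 * m" | "2 * m \<le> i" "i < 3 * m" "4 * m \<le> Suc (i + j)"
    | "m \<le> j" "j < 2 * m" "2 * m \<le> Suc (i + j)" "i + j < 4 * m" "i < 3 * m"
    using assms by linarith
  then show ?thesis
  proof cases
    case 1
    then show ?thesis unfolding zigzag_def by (intro exI[of _ i]) auto
  next
    case 2
    then show ?thesis unfolding zigzag_def by (intro exI[of _ "i - 2 * m"]) auto
  next
    case 3
    then show ?thesis unfolding zigzag_def by (intro exI[of _ "2 * m - Suc j"]) auto
  qed
qed

lemma grid_cover_pinwheel: "grid_cover (3 * m) m m"
proof -
  \<comment> \<open>The rotation reverses \<open>j\<close> and keeps \<open>i\<close>, which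
    exchanges monotone and antitone; the guard \<open>j < 3 * m\<close> keeps the subtraction from
    truncating.\<close>
  let ?S = "\<lambda>t. {(i, j). j < 3 * m \<and> (3 * m - Suc j, i) \<in> zigzag m t}"
  have "antitone_cells (?S t)" for t
  proof -
    have "\<not> (i < i' \<and> j < j')"
      if "j < 3 * m" "(3 * m - Suc j, i) \<in> zigzag m t" "j' < 3 * m" "(3 * m - Suc j', i') \<in> zigzag m t"
      for i j i' j'
    proof
      assume "i < i' \<and> j < j'"
      then have "3 * m - Suc j' < 3 * m - Suc j" "i < i'" using that by auto
      then show False using monotone_zigzag[of m t] that unfolding monotone_cells_def by fast
    qed
    then show ?thesis unfolding antitone_cells_def by blast
  qed
  moreover have "(\<exists>t<m. (i, j) \<in> ?S t) \<or> (\<exists>t<m. (i, j) \<in> zigzag m t)"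
    if "i < 3 * m" "j < 3 * m" for i j
  \<comment> \<open>These are the four blocks \<open>(0,2)\<close>, \<open>(1,2)\<close>,
    \<open>(1,0)\<close>, \<open>(2,0)\<close> that the unrotated paths leave to the rotated
    ones.\<close>
  proof (cases "i < 2 * m \<and> 2 * m \<le> j \<or> m \<le> i \<and> j < m")
    case True
    then have "\<exists>t<m. (3 * m - Suc j, i) \<in> zigzag m t"
      using that by (intro zigzag_cover) linarith
    then show ?thesis using that by simp
  next
    case False
    then have "\<exists>t<m. (i, j) \<in> zigzag m t" using that by (intro zigzag_cover) linarith
    then show ?thesis ..
  qed
  then have "{..<3 * m} \<times> {..<3 * m} \<subseteq> (\<Union>t<m. ?S t) \<union> (\<Union>t<m. zigzag m t)"
    by (simp add: subset_iff Bex_def)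
  ultimately show ?thesis unfolding grid_cover_def using monotone_zigzag by meson
qed

section \<open>From grid covers to partitions of the edges\<close>

definition std_order :: "nat \<Rightarrow> vertex rel" where
  "std_order n = {(x, y) \<in> Knn_verts n \<times> Knn_verts n.
     case_sum id (\<lambda>j. n + j) x < case_sum id (\<lambda>j. n + j) y}"

lemma vertex_order_std: "vertex_order n (std_order n)"
proof -
  have "inj_on (case_sum id (\<lambda>j. n + j)) (Knn_verts n)"
    unfolding inj_on_def Knn_verts_def part_U_def part_V_def by auto
  then have "total_on (Knn_verts n) (std_order n)"
    unfolding total_on_def std_order_def inj_on_def by (fastforce simp: linorder_neq_iff)
  moreover have "trans (std_order n)" "irrefl (std_order n)"
    unfolding std_order_def by (auto intro!: transI simp: irrefl_def)
  ultimately show ?thesis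
    unfolding vertex_order_def strict_linear_order_on_def by (auto simp: std_order_def)
qed

lemma separated_std: "separated n (std_order n)"
  unfolding separated_def std_order_def Knn_verts_def part_U_def part_V_def by auto

lemma std_order_simps:
  "(Inl i, Inl i') \<in> std_order n \<longleftrightarrow> i < i' \<and> i' < n"
  "(Inr j, Inr j') \<in> std_order n \<longleftrightarrow> j < j' \<and> j' < n"
  "(Inr j, Inl i) \<notin> std_order n"
  unfolding std_order_def Knn_verts_def part_U_def part_V_def by auto

lemma cross_std:
  "cross (std_order n) {Inl i, Inr j} {Inl i', Inr j'} \<Longrightarrow> i < i' \<and> j < j'"
  unfolding cross_def by (auto simp: doubleton_eq_iff std_order_simps)

lemma nest_std:
  "nest (std_order n) {Inl i, Inr j} {Inl i', Inr j'} \<Longrightarrow> i < i' \<and> j' < j"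
  unfolding nest_def by (auto simp: doubleton_eq_iff std_order_simps)

lemma partition_on_fibres:
  assumes "\<And>x. x \<in> A \<Longrightarrow> c x \<in> I"
  shows "partition_on A ((\<lambda>t. {x \<in> A. c x = t}) ` I - {{}})"
  using assms by (intro partition_onI) (auto simp: disjnt_def)

text \<open>Each edge chooses one path through its cell, and the fibres of this choice are the
  blocks. Empty fibres are discarded, so the counts may drop.\<close>

lemma grid_cover_mixed_partition:
  assumes "grid_cover n s q"
  shows "\<exists>s' q'. s' + q' \<le> s + q \<and> mixed_partition (std_order n) (Knn_edges n) s' q'"
proof -
  obtain S Q where S: "\<And>t. t < s \<Longrightarrow> antitone_cells (S t)" and Q: "\<And>t. t < q \<Longrightarrow> monotone_cells (Q t)"
    and cover: "{..<n} \<times> {..<n} \<subseteq> (\<Union>t<s. S t) \<union> (\<Union>t<q. Q t)"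
    using assms unfolding grid_cover_def by blast
  \<comment> \<open>The tag \<open>Inl\<close> marks a stack and \<open>Inr\<close> a queue, so a
    nonempty fibre cannot belong to both families.\<close>
  define P where "P e t = (\<exists>i j. e = {Inl i, Inr j} \<and> (case t of Inl t \<Rightarrow> t < s \<and> (i, j) \<in> S t
    | Inr t \<Rightarrow> t < q \<and> (i, j) \<in> Q t))" for e :: "vertex set" and t :: "nat + nat"
  have "\<exists>t. P e t" if e: "e \<in> Knn_edges n" for e
  proof -
    obtain i j where ij: "e = {Inl i, Inr j}" "i < n" "j < n"
      using e unfolding Knn_edges_def part_U_def part_V_def by auto
    then have "(\<exists>t<s. (i, j) \<in> S t) \<or> (\<exists>t<q. (i, j) \<in> Q t)" using cover by blast
    then show ?thesis
    proof
      assume "\<exists>t<s. (i, j) \<in> S t"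
      then obtain t where "t < s" "(i, j) \<in> S t" by blast
      then have "P e (Inl t)" unfolding P_def using ij(1) by auto
      then show ?thesis ..
    next
      assume "\<exists>t<q. (i, j) \<in> Q t"
      then obtain t where "t < q" "(i, j) \<in> Q t" by blast
      then have "P e (Inr t)" unfolding P_def using ij(1) by auto
      then show ?thesis ..
    qed
  qed
  then obtain c where c: "\<And>e. e \<in> Knn_edges n \<Longrightarrow> P e (c e)" by metis
  define K where "K t = {e \<in> Knn_edges n. c e = t}" for t
  define \<S> where "\<S> = K ` Inl ` {..<s} - {{}}"
  define \<Q> where "\<Q> = K ` Inr ` {..<q} - {{}}"
  have "c e \<in> Inl ` {..<s} \<union> Inr ` {..<q}" if "e \<in> Knn_edges n" for e
    using c[OF that] unfolding P_def by (cases "c e") auto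
  then have "partition_on (Knn_edges n) (K ` (Inl ` {..<s} \<union> Inr ` {..<q}) - {{}})"
    unfolding K_def by (rule partition_on_fibres)
  moreover have "K ` (Inl ` {..<s} \<union> Inr ` {..<q}) - {{}} = \<S> \<union> \<Q>"
    unfolding \<S>_def \<Q>_def by blast
  ultimately have "partition_on (Knn_edges n) (\<S> \<union> \<Q>)" by simp
  moreover have "\<S> \<inter> \<Q> = {}"
  proof (rule equals0I)
    fix X assume "X \<in> \<S> \<inter> \<Q>"
    then obtain t u e where "X = K (Inl t)" "X = K (Inr u)" "e \<in> X"
      unfolding \<S>_def \<Q>_def by auto
    then have "c e = Inl t" "c e = Inr u" unfolding K_def by blast+
    then show False by simp
  qed
  moreover have "finite \<S>" "finite \<Q>" unfolding \<S>_def \<Q>_def by auto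
  moreover have "stack (std_order n) X" if XS: "X \<in> \<S>" for X
    unfolding stack_def
  proof (intro ballI notI)
    fix e f assume ef: "e \<in> X" "f \<in> X" "cross (std_order n) e f"
    obtain t where X: "X = K (Inl t)" "t < s" using XS unfolding \<S>_def by auto
    obtain i j where e: "e = {Inl i, Inr j}" "(i, j) \<in> S t"
      using ef(1) c[of e] unfolding X(1) K_def P_def by auto
    obtain i' j' where f: "f = {Inl i', Inr j'}" "(i', j') \<in> S t"
      using ef(2) c[of f] unfolding X(1) K_def P_def by auto
    show False
      using cross_std[of n i j i' j'] S[OF X(2)] ef(3) e f unfolding antitone_cells_def by blast
  qed
  moreover have "queue (std_order n) X" if XQ: "X \<in> \<Q>" for X
    unfolding queue_def
  proof (intro ballI notI)
    fix e f assume ef: "e \<in> X" "f \<in> X" "nest (std_order n) e f"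
    obtain t where X: "X = K (Inr t)" "t < q" using XQ unfolding \<Q>_def by auto
    obtain i j where e: "e = {Inl i, Inr j}" "(i, j) \<in> Q t"
      using ef(1) c[of e] unfolding X(1) K_def P_def by auto
    obtain i' j' where f: "f = {Inl i', Inr j'}" "(i', j') \<in> Q t"
      using ef(2) c[of f] unfolding X(1) K_def P_def by auto
    show False
      using nest_std[of n i j i' j'] Q[OF X(2)] ef(3) e f unfolding monotone_cells_def by blast
  qed
  ultimately have "mixed_partition (std_order n) (Knn_edges n) (card \<S>) (card \<Q>)"
    unfolding mixed_partition_def by blast
  moreover have "card \<S> \<le> s"
    unfolding \<S>_def image_image by (rule order_trans[OF card_Diff1_le])
      (metis card_image_le card_lessThan finite_lessThan)
  moreover have "card \<Q> \<le> q"
    unfolding \<Q>_def image_image by (rule order_trans[OF card_Diff1_le])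
      (metis card_image_le card_lessThan finite_lessThan)
  ultimately show ?thesis by (meson add_mono)
qed

text \<open>The pinwheel settles \<open>n = 3m\<close>; \<open>n = 3m + 1\<close> costs one more
  stack, and \<open>n = 3m + 2\<close> is cut out of the pinwheel of size \<open>3(m + 1)\<close>.
  The bound is the ceiling of \<open>2n/3\<close>.\<close>

lemma grid_cover_two_thirds: "\<exists>s q. s + q \<le> (2 * n + 2) div 3 \<and> grid_cover n s q"
proof -
  define m where "m = n div 3"
  consider "n = 3 * m" | "n = Suc (3 * m)" | "n = 3 * m + 2" unfolding m_def by linarith
  then show ?thesis
  proof cases
    case 1
    then show ?thesis using grid_cover_pinwheel[of m] by (intro exI[of _ m]) auto
  next
    case 2
    then show ?thesis using grid_cover_Suc[OF grid_cover_pinwheel[of m]]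
      by (intro exI[of _ "Suc m"] exI[of _ m]) auto
  next
    case 3
    then show ?thesis using grid_cover_mono[OF grid_cover_pinwheel[of "Suc m"], of n]
      by (intro exI[of _ "Suc m"]) auto
  qed
qed

theorem theorem4:
  fixes n :: nat
  assumes "n \<ge> 1"
  shows "int (mixed_separated_number n) = \<lceil>2 * real n / 3\<rceil>"
proof -
  define R where "R k \<longleftrightarrow> (\<exists>s q r. k = s + q \<and> vertex_order n r \<and> separated n r \<and>
        mixed_partition r (Knn_edges n) s q)" for k
  have num: "mixed_separated_number n = (LEAST k. R k)"
    unfolding mixed_separated_number_def R_def ..
  obtain s q where "s + q \<le> (2 * n + 2) div 3" "mixed_partition (std_order n) (Knn_edges n) s q"
    using grid_cover_two_thirds[of n] grid_cover_mixed_partition by (meson order_trans)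
  then have sq: "s + q \<le> (2 * n + 2) div 3" "R (s + q)"
    unfolding R_def using vertex_order_std separated_std by blast+
  have "R (mixed_separated_number n)" unfolding num using sq(2) by (rule LeastI)
  then have "2 * n \<le> 3 * mixed_separated_number n"
    unfolding R_def using separated_lower_bound by metis
  moreover have "mixed_separated_number n \<le> (2 * n + 2) div 3"
    unfolding num using Least_le[of R, OF sq(2)] sq(1) by linarith
  ultimately have "mixed_separated_number n = (2 * n + 2) div 3" by linarith
  then show ?thesis by linarith
qed

end
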